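(* Let $n\ge 3$, let $K$ be a field, let $\mathcal{A}=K[x_0,x_1,\ldots,x_n,x_{n+1},\ldots,x_{2n}]$, and let $L=CNI(H_{0,2n})\subseteq\mathcal{A}$ be the closed neighborhood ideal of the Helm graph $H_{0,2n}$. Then the height of $L$ is $\operatorname{ht}(L)=n$, and the Krull dimension of $\mathcal{A}/L$ is $\dim(\mathcal{A}/L)=n+1$.
   Context: For $n\ge 3$, the Helm graph $H_{0,2n}$ is the simple graph with vertex set $\{x_0,x_1,\ldots,x_n,x_{n+1},\ldots,x_{2n}\}$ and edge set $$E(C_n)\cup\{\{x_0,x_i\}:1\le i\le n\}\cup\{\{x_i,x_{n+i}\}:1\le i\le n\},$$ where $E(C_n)=\{\{x_i,x_{i+1}\}:1\le i\le n-1\}\cup\{\{x_n,x_1\}\}$. The closed neighborhood ideal $CNI(G)$ of a graph $G$ is the monomial ideal generated by the products $\prod_{x_j\in N[x_i]}x_j$ for $x_i\in V(G)$, where $N[x_i]=\{x_i\}\cup\{x_j:\{x_i,x_j\}\in E(G)\}$. For the Helm graph, $$L=CNI(H_{0,2n})=(x_1x_{n+1},\,x_2x_{n+2},\ldots,x_nx_{2n},\,x_0x_1x_2\cdots x_n).$$ *)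

theory Defs
  imports "HOL-Algebra.QuotRing" "HOL-Library.Poly_Mapping" "HOL-Library.Extended_Nat"
begin

section \<open>Polynomial rings\<close>

text \<open>
  An exponent vector is a finitely supported map from variables to \<^typ>\<open>nat\<close>; a polynomial is
  a finitely supported map from exponent vectors to coefficients, and the library's
  multiplication on this type is convolution. The type has a variable for every element
  of \<^typ>\<open>'v\<close>, so the polynomial ring in the variables \<open>V\<close> is cut out by a carrier.
\<close>

type_synonym ('v, 'k) mpoly = "('v \<Rightarrow>\<^sub>0 nat) \<Rightarrow>\<^sub>0 'k"

definition poly_ring :: "'v set \<Rightarrow> ('v, 'k::comm_ring_1) mpoly ring" where
  "poly_ring V =
    \<lparr>carrier = {p. \<forall>m \<in> Poly_Mapping.keys p. Poly_Mapping.keys m \<subseteq> V},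
     mult = (*), one = 1, zero = 0, add = (+)\<rparr>"

definition var :: "'v \<Rightarrow> ('v, 'k::comm_ring_1) mpoly" where
  "var i = Poly_Mapping.single (Poly_Mapping.single i 1) 1"

lemma cring_poly_ring: "cring (poly_ring V :: ('v, 'k::comm_ring_1) mpoly ring)"
proof (rule cringI)
  let ?R = "poly_ring V :: ('v, 'k) mpoly ring"
  have add_closed: "p + q \<in> carrier ?R" if "p \<in> carrier ?R" "q \<in> carrier ?R" for p q
    using that Poly_Mapping.keys_add[of p q] by (simp add: poly_ring_def) blast
  have mult_closed: "p * q \<in> carrier ?R" if pq: "p \<in> carrier ?R" "q \<in> carrier ?R" for p q
  proof -
    have "Poly_Mapping.keys m \<subseteq> V" if m: "m \<in> Poly_Mapping.keys (p * q)" for m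
    proof -
      obtain a b where ab: "m = a + b" "a \<in> Poly_Mapping.keys p" "b \<in> Poly_Mapping.keys q"
        using m Poly_Mapping.keys_mult[of p q] by blast
      then show ?thesis
        using pq Poly_Mapping.keys_add[of a b] by (simp add: poly_ring_def) blast
    qed
    then show ?thesis unfolding poly_ring_def by simp
  qed
  show "abelian_group ?R"
  proof (rule abelian_groupI)
    show "p \<oplus>\<^bsub>?R\<^esub> q \<in> carrier ?R" if "p \<in> carrier ?R" "q \<in> carrier ?R" for p q
      using add_closed[OF that] by (simp add: poly_ring_def)
    show "\<exists>q \<in> carrier ?R. q \<oplus>\<^bsub>?R\<^esub> p = \<zero>\<^bsub>?R\<^esub>" if "p \<in> carrier ?R" for p
      by (rule bexI[of _ "- p"]) (use that in \<open>simp_all add: poly_ring_def in_keys_iff\<close>)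
  qed (simp_all add: poly_ring_def add_ac)
  show "Group.comm_monoid ?R"
  proof (rule Group.comm_monoidI)
    show "p \<otimes>\<^bsub>?R\<^esub> q \<in> carrier ?R" if "p \<in> carrier ?R" "q \<in> carrier ?R" for p q
      using mult_closed[OF that] by (simp add: poly_ring_def)
  qed (simp_all add: poly_ring_def mult_ac)
qed (simp add: poly_ring_def distrib_right)


section \<open>Height and Krull dimension\<close>

text \<open>The chain \<open>P 0 \<subset> P 1 \<subset> \<dots> \<subset> P k\<close> of prime ideals has length \<open>k\<close>.\<close>

definition prime_chain :: "('a, 'b) ring_scheme \<Rightarrow> nat \<Rightarrow> (nat \<Rightarrow> 'a set) \<Rightarrow> bool" where
  "prime_chain R k P \<longleftrightarrow> (\<forall>i\<le>k. primeideal (P i) R) \<and> (\<forall>i<k. P i \<subset> P (Suc i))"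

definition prime_height :: "('a, 'b) ring_scheme \<Rightarrow> 'a set \<Rightarrow> enat" where
  "prime_height R Q = Sup {enat k | k P. prime_chain R k P \<and> P k = Q}"

text \<open>The unit ideal lies in no prime and gets height \<open>\<infinity>\<close>.\<close>

definition height :: "('a, 'b) ring_scheme \<Rightarrow> 'a set \<Rightarrow> enat" where
  "height R I = (INF Q \<in> {Q. primeideal Q R \<and> I \<subseteq> Q}. prime_height R Q)"

text \<open>
  The zero ring, which has no primes, gets dimension \<open>0\<close> here since \<^typ>\<open>enat\<close> has no
  negative elements.
\<close>

definition krull_dim :: "('a, 'b) ring_scheme \<Rightarrow> enat" where
  "krull_dim R = Sup {enat k | k P. prime_chain R k P}"


section \<open>Closed neighborhood ideals and Helm graphs\<close>

record 'v graph =
  vertices :: "'v set"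
  edges :: "'v set set"

definition closed_nbhd :: "'v graph \<Rightarrow> 'v \<Rightarrow> 'v set" where
  "closed_nbhd G x = {x} \<union> {y. {x, y} \<in> edges G}"

definition CNI :: "'v graph \<Rightarrow> ('v, 'k::field) mpoly set" where
  "CNI G = Idl\<^bsub>poly_ring (vertices G)\<^esub> ((\<lambda>x. \<Prod>y \<in> closed_nbhd G x. var y) ` vertices G)"

text \<open>The vertex \<open>x\<^sub>i\<close> is the number \<open>i\<close>.\<close>

definition helm_graph :: "nat \<Rightarrow> nat graph" where
  "helm_graph n =
    \<lparr>vertices = {0..2 * n},
     edges = ({{i, i + 1} | i. 1 \<le> i \<and> i \<le> n - 1} \<union> {{n, 1}})
       \<union> {{0, i} | i. 1 \<le> i \<and> i \<le> n}
       \<union> {{i, n + i} | i. 1 \<le> i \<and> i \<le> n}\<rparr>"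

lemma helm_graph_simple:
  assumes "n \<ge> 3" and "e \<in> edges (helm_graph n)"
  shows "e \<subseteq> vertices (helm_graph n)" and "card e = 2"
  using assms by (auto simp: helm_graph_def card_insert_if)

end

theory Submission
  imports Defs
begin

text \<open>
  Let \<open>K[V]\<close> be a polynomial ring in finitely many variables. Everything rests on one fact about
  it, \<open>dim K[V] \<le> |V|\<close> (\<open>prime_chain_length_le\<close>). Given a chain of primes of length \<open>k\<close>, choose an
  element that is new at each step. By \<open>pow_prods_independent_mod_prime\<close> the monomials in these
  \<open>k\<close> elements are linearly independent over \<open>K\<close>, and \<open>k\<close> polynomials with this property exist
  only for \<open>k \<le> |V|\<close>: among the polynomials with exponents \<open>O(N)\<close> there are \<open>(N + 1)\<^sup>k\<close> such
  monomials, but the space has dimension \<open>O(N\<^bsup>|V|\<^esup>)\<close>.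

  The ideals generated by sets of variables are prime, and adding variables one by one gives
  chains of known length (\<open>var_ideal_flag\<close>). Suppose that an ideal \<open>I\<close> lies in the ideal of a
  set \<open>S\<close> of variables, while every prime above \<open>I\<close> contains at least \<open>|S|\<close> variables. Flags then give the
  lower bounds \<open>|S|\<close> for the height of \<open>I\<close> and \<open>|V| - |S|\<close> for the dimension of \<open>K[V]/I\<close>; splicing an
  arbitrary chain with a flag and comparing with \<open>|V|\<close> gives the same numbers as upper bounds
  (\<open>height_krull_dim_by_covers\<close>).

  For the Helm graph, \<open>V\<close> has \<open>2 n + 1\<close> elements and \<open>S\<close> is the rim \<open>x\<^sub>1, \<dots>, x\<^sub>n\<close>, which meets every
  closed neighborhood. A prime above the closed neighborhood ideal contains
  \<open>x\<^sub>i x\<^bsub>n+i\<^esub>\<close> for \<open>1 \<le> i \<le> n\<close>, hence one variable of each of these \<open>n\<close> disjoint pairs.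
\<close>

section \<open>Ideals of polynomial rings, elementwise\<close>

lemma in_carrier_poly_ring:
  "p \<in> carrier (poly_ring V) \<longleftrightarrow> (\<forall>m \<in> Poly_Mapping.keys p. Poly_Mapping.keys m \<subseteq> V)"
  by (simp add: poly_ring_def)

lemma poly_ring_simps [simp]:
  "mult (poly_ring V) = (*)" "one (poly_ring V) = 1"
  "zero (poly_ring V) = 0" "add (poly_ring V) = (+)"
  by (simp_all add: poly_ring_def)

lemma sum_single_lookup:
  "(\<Sum>m\<in>Poly_Mapping.keys p. Poly_Mapping.single m (Poly_Mapping.lookup p m)) = p"
  by (rule poly_mapping_eqI) (simp add: lookup_sum lookup_single when_def in_keys_iff)

lemma single_in_carrier:
  "Poly_Mapping.keys m \<subseteq> V \<Longrightarrow> Poly_Mapping.single m c \<in> carrier (poly_ring V)"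
  by (simp add: in_carrier_poly_ring)

lemma var_in_carrier: "x \<in> V \<Longrightarrow> var x \<in> carrier (poly_ring V)"
  by (simp add: var_def single_in_carrier)

lemma poly_ring_closed:
  fixes p q :: "('v, 'k::comm_ring_1) mpoly"
  assumes "p \<in> carrier (poly_ring V)" "q \<in> carrier (poly_ring V)"
  shows "p + q \<in> carrier (poly_ring V)" "p * q \<in> carrier (poly_ring V)"
proof -
  interpret cring "poly_ring V :: ('v, 'k) mpoly ring" by (rule cring_poly_ring)
  show "p + q \<in> carrier (poly_ring V)" "p * q \<in> carrier (poly_ring V)"
    using a_closed[OF assms] m_closed[OF assms] by simp_all
qed

lemma power_in_carrier:
  assumes "p \<in> carrier (poly_ring V)"
  shows "p ^ e \<in> carrier (poly_ring V)"
  using assms by (induction e) (auto intro: poly_ring_closed simp: in_carrier_poly_ring[of 1])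

lemma ideal_poly_ringD:
  fixes P :: "('v, 'k::comm_ring_1) mpoly set"
  assumes "ideal P (poly_ring V)"
  shows "P \<subseteq> carrier (poly_ring V)" "0 \<in> P"
    "p \<in> P \<Longrightarrow> q \<in> P \<Longrightarrow> p + q \<in> P"
    "p \<in> P \<Longrightarrow> q \<in> P \<Longrightarrow> p - q \<in> P"
    "p \<in> P \<Longrightarrow> r \<in> carrier (poly_ring V) \<Longrightarrow> r * p \<in> P"
proof -
  interpret ideal P "poly_ring V" by (rule assms)
  show "P \<subseteq> carrier (poly_ring V)" by (rule a_subset)
  show "0 \<in> P" using additive_subgroup.zero_closed[OF is_additive_subgroup] by simp
  show add: "p + q \<in> P" if "p \<in> P" "q \<in> P" for p q
    using additive_subgroup.a_closed[OF is_additive_subgroup that] by simp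
  show mult: "r * p \<in> P" if "p \<in> P" "r \<in> carrier (poly_ring V)" for p r
    using I_l_closed[OF that] by simp
  have "- 1 \<in> carrier (poly_ring V :: ('v, 'k) mpoly ring)"
    by (simp add: in_carrier_poly_ring in_keys_iff lookup_one)
  then show "p - q \<in> P" if "p \<in> P" "q \<in> P"
    using add[OF that(1) mult[OF that(2), of "- 1"]] by simp
qed

lemma ideal_sum_closed:
  assumes "ideal P (poly_ring V)" "\<And>i. i \<in> I \<Longrightarrow> f i \<in> P"
  shows "sum f I \<in> P"
  using assms(2)
  by (induction I rule: infinite_finite_induct) (auto intro: ideal_poly_ringD(2,3)[OF assms(1)])

lemma primeideal_poly_ringD:
  fixes P :: "('v, 'k::comm_ring_1) mpoly set"
  assumes "primeideal P (poly_ring V)"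
  shows "ideal P (poly_ring V)" "1 \<notin> P"
    "p \<in> carrier (poly_ring V) \<Longrightarrow> q \<in> carrier (poly_ring V) \<Longrightarrow> p * q \<in> P \<Longrightarrow> p \<in> P \<or> q \<in> P"
proof -
  interpret primeideal P "poly_ring V" by (rule assms)
  show "ideal P (poly_ring V)" by (rule is_ideal)
  show "1 \<notin> P" using one_imp_carrier I_notcarr by auto
  show "p \<in> carrier (poly_ring V) \<Longrightarrow> q \<in> carrier (poly_ring V) \<Longrightarrow> p * q \<in> P \<Longrightarrow> p \<in> P \<or> q \<in> P"
    using I_prime[of p q] by simp
qed

lemma primeideal_power_cancel:
  assumes P: "primeideal P (poly_ring V)"
    and "p \<in> carrier (poly_ring V)" "q \<in> carrier (poly_ring V)" "p ^ e * q \<in> P" "p \<notin> P"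
  shows "q \<in> P"
  using assms(4)
proof (induction e)
  case (Suc e)
  then have "p * (p ^ e * q) \<in> P" by (simp add: mult.assoc)
  then have "p ^ e * q \<in> P"
    using primeideal_poly_ringD(3)[OF P assms(2) poly_ring_closed(2)[OF power_in_carrier assms(3)]]
      assms(2,5) by blast
  then show ?case by (rule Suc.IH)
qed simp

section \<open>Monomials along a chain of primes\<close>

fun pow_prod :: "'a::comm_monoid_mult list \<Rightarrow> nat list \<Rightarrow> 'a" where
  "pow_prod (a # as) (e # es) = a ^ e * pow_prod as es"
| "pow_prod _ _ = 1"

lemma pow_prod_in_carrier:
  "set as \<subseteq> carrier (poly_ring V) \<Longrightarrow> pow_prod as es \<in> carrier (poly_ring V)"
  by (induction as es rule: pow_prod.induct)
     (auto intro: poly_ring_closed power_in_carrier simp: in_carrier_poly_ring[of 1])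

text \<open>
  The Coquand--Lombardi view of Krull dimension: if \<open>a\<^sub>i\<close> enters the chain exactly between
  \<open>P i\<close> and \<open>P (i + 1)\<close>, a \<open>K\<close>-linear relation between monomials in the \<open>a\<^sub>i\<close> modulo \<open>P 0\<close>
  can be peeled off. Let \<open>d\<close> be the least exponent of \<open>a\<^sub>0\<close> in it. As \<open>a\<^sub>0 \<notin> P 0\<close>, the factor
  \<open>a\<^sub>0\<^sup>d\<close> may be cancelled; as \<open>a\<^sub>0 \<in> P 1\<close>, all terms still divisible by \<open>a\<^sub>0\<close> vanish modulo
  \<open>P 1\<close>. The remaining terms are a shorter relation, between monomials in \<open>a\<^sub>1, a\<^sub>2, \<dots>\<close>, for
  the chain that starts at \<open>P 1\<close>. In the end a nonzero constant would lie in a prime ideal.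
  Taking only the terms with nonzero coefficients makes the conclusion \<open>E = {}\<close>, which is what
  the induction needs.
\<close>

lemma pow_prods_independent_mod_prime:
  fixes as :: "('v, 'k::field) mpoly list"
  assumes "prime_chain (poly_ring V) (length as) P"
    and "\<And>i. i < length as \<Longrightarrow> as ! i \<in> P (Suc i) - P i"
    and "finite E" "\<And>es. es \<in> E \<Longrightarrow> length es = length as" "\<And>es. es \<in> E \<Longrightarrow> c es \<noteq> 0"
    and "(\<Sum>es\<in>E. Poly_Mapping.single 0 (c es) * pow_prod as es) \<in> P 0"
  shows "E = {}"
  using assms
proof (induction as arbitrary: P E c)
  case Nil
  then have P0: "primeideal (P 0) (poly_ring V)" by (simp add: prime_chain_def)
  show ?case
  proof (rule ccontr)
    assume "E \<noteq> {}"
    then have E: "E = {[]}" using Nil(4) by auto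
    then have "Poly_Mapping.single 0 (c []) \<in> P 0" using Nil(6) by simp
    then have "Poly_Mapping.single 0 (inverse (c [])) * Poly_Mapping.single 0 (c []) \<in> P 0"
      by (intro ideal_poly_ringD(5)[OF primeideal_poly_ringD(1)[OF P0]] single_in_carrier) simp_all
    moreover have "Poly_Mapping.single 0 (inverse (c [])) * Poly_Mapping.single 0 (c [])
        = (1 :: ('v, 'k) mpoly)"
      using Nil(5) E by (simp add: mult_single)
    ultimately show False using primeideal_poly_ringD(2)[OF P0] by simp
  qed
next
  case (Cons a as)
  have prime: "primeideal (P i) (poly_ring V)" if "i \<le> Suc (length as)" for i
    using Cons.prems(1) that by (simp add: prime_chain_def)
  have mono: "P i \<subset> P (Suc i)" if "i < Suc (length as)" for i
    using Cons.prems(1) that by (simp add: prime_chain_def)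
  note P0 = prime[of 0, simplified]
    and P1 = prime[of 1, unfolded One_nat_def, simplified, folded One_nat_def]
  note I1 = primeideal_poly_ringD(1)[OF P1]
  have aP: "a \<in> P 1" "a \<notin> P 0" using Cons.prems(2)[of 0] by auto
  have "P (Suc i) \<subseteq> carrier (poly_ring V)" if "i < length (a # as)" for i
    using ideal_poly_ringD(1)[OF primeideal_poly_ringD(1)[OF prime[of "Suc i"]]] that by simp
  then have carr: "set (a # as) \<subseteq> carrier (poly_ring V)"
    using Cons.prems(2) by (fastforce simp: set_conv_nth)
  show ?case
  proof (rule ccontr)
    assume "E \<noteq> {}"
    define d where "d = Min (hd ` E)"
    have d_le: "d \<le> hd es" if "es \<in> E" for es
      unfolding d_def using that Cons.prems(3) by simp
    have "d \<in> hd ` E" unfolding d_def using \<open>E \<noteq> {}\<close> Cons.prems(3) by (intro Min_in) auto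
    define T where "T es = Poly_Mapping.single 0 (c es) * pow_prod as (tl es)" for es
    have Tc: "T es \<in> carrier (poly_ring V)" for es
      unfolding T_def using carr
      by (intro poly_ring_closed power_in_carrier pow_prod_in_carrier single_in_carrier) auto
    \<comment> \<open>\<open>s\<close> below is the relation after cancelling the common factor \<open>a ^ d\<close>\<close>
    have factor: "Poly_Mapping.single 0 (c es) * pow_prod (a # as) es = a ^ d * (a ^ (hd es - d) * T es)"
      if es: "es \<in> E" for es
    proof -
      obtain e es' where "es = e # es'" using Cons.prems(4)[OF es] by (cases es) auto
      moreover have "a ^ e = a ^ d * a ^ (e - d)"
        using d_le[OF es] calculation by (simp flip: power_add)
      ultimately show ?thesis by (simp add: T_def mult_ac)
    qed
    define s where "s = (\<Sum>es\<in>E. a ^ (hd es - d) * T es)"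
    have "a ^ d * s \<in> P 0"
      using Cons.prems(6) factor by (simp add: s_def sum_distrib_left cong: sum.cong)
    moreover have "s \<in> carrier (poly_ring V)"
      unfolding s_def using cring.axioms(1)[OF cring_poly_ring[of V]] carr Tc
      by (intro ideal_sum_closed[OF ring.oneideal] poly_ring_closed power_in_carrier) auto
    ultimately have "s \<in> P 0" using primeideal_power_cancel[OF P0 _ _ _ aP(2)] carr by auto
    have "P 0 \<subseteq> P 1" using mono[of 0] by auto
    \<comment> \<open>the part of \<open>s\<close> that is still divisible by \<open>a\<close>\<close>
    define s' where "s' = (\<Sum>es\<in>{es\<in>E. hd es \<noteq> d}. a ^ (hd es - d) * T es)"
    have "s' \<in> P 1"
      unfolding s'_def
    proof (rule ideal_sum_closed[OF I1])
      fix es assume "es \<in> {es\<in>E. hd es \<noteq> d}"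
      then obtain j where "hd es - d = Suc j"
        using d_le[of es]
        by (metis (mono_tags) diff_is_0_eq le_antisym mem_Collect_eq not0_implies_Suc)
      then have "a ^ (hd es - d) * T es = (a ^ j * T es) * a" by (simp add: mult_ac)
      moreover have "(a ^ j * T es) * a \<in> P 1"
        using carr Tc
        by (intro ideal_poly_ringD(5)[OF I1 aP(1)] poly_ring_closed power_in_carrier) auto
      ultimately show "a ^ (hd es - d) * T es \<in> P 1" by simp
    qed
    moreover have "s \<in> P 1" using \<open>s \<in> P 0\<close> \<open>P 0 \<subseteq> P 1\<close> by blast
    moreover have "s = (\<Sum>es\<in>{es\<in>E. hd es = d}. a ^ (hd es - d) * T es) + s'"
      unfolding s_def s'_def using Cons.prems(3)
      by (subst sum.union_disjoint[symmetric]) (auto intro!: sum.cong)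
    then have "s - s' = (\<Sum>es\<in>{es\<in>E. hd es = d}. T es)" by simp
    ultimately have lowest: "(\<Sum>es\<in>{es\<in>E. hd es = d}. T es) \<in> P 1"
      using ideal_poly_ringD(4)[OF I1, of s s'] by (simp only:)
    \<comment> \<open>dropping the first exponent is injective here, since it is \<open>d\<close> throughout\<close>
    define E' where "E' = tl ` {es\<in>E. hd es = d}"
    have cons_tl: "d # tl es = es" if "es \<in> {es\<in>E. hd es = d}" for es
      using Cons.prems(4)[of es] that by (cases es) auto
    then have inj: "inj_on tl {es\<in>E. hd es = d}" by (intro inj_on_inverseI)
    have "E' = {}"
    proof (rule Cons.IH[where P = "\<lambda>i. P (Suc i)" and c = "\<lambda>es. c (d # es)"])
      show "prime_chain (poly_ring V) (length as) (\<lambda>i. P (Suc i))"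
        using prime mono by (simp add: prime_chain_def)
      show "as ! i \<in> P (Suc (Suc i)) - P (Suc i)" if "i < length as" for i
        using Cons.prems(2)[of "Suc i"] that by simp
      show "finite E'" unfolding E'_def using Cons.prems(3) by simp
      show "length es = length as" if "es \<in> E'" for es
        using that Cons.prems(4) by (auto simp: E'_def)
      show "c (d # es) \<noteq> 0" if "es \<in> E'" for es
        using that Cons.prems(5) cons_tl by (auto simp: E'_def)
      show "(\<Sum>es\<in>E'. Poly_Mapping.single 0 (c (d # es)) * pow_prod as es) \<in> P (Suc 0)"
      proof -
        have "(\<Sum>es\<in>E'. Poly_Mapping.single 0 (c (d # es)) * pow_prod as es)
            = (\<Sum>es\<in>{es\<in>E. hd es = d}. T es)"
          unfolding E'_def sum.reindex[OF inj] T_def using cons_tl by (intro sum.cong) auto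
        with lowest show ?thesis by simp
      qed
    qed
    then show False using \<open>d \<in> hd ` E\<close> by (auto simp: E'_def)
  qed
qed

section \<open>The dimension of a polynomial ring\<close>

text \<open>
  Bounding each exponent separately, rather than the total degree, makes the number of
  monomials trivial to count; it still grows additively under multiplication.
\<close>

definition exponent_box :: "'v set \<Rightarrow> nat \<Rightarrow> ('v \<Rightarrow>\<^sub>0 nat) set" where
  "exponent_box V d = {m. Poly_Mapping.keys m \<subseteq> V \<and> (\<forall>x. Poly_Mapping.lookup m x \<le> d)}"

lemma keys_mult_subset_exponent_box:
  fixes p q :: "('v, 'k::comm_ring_1) mpoly"
  assumes "Poly_Mapping.keys p \<subseteq> exponent_box V d" "Poly_Mapping.keys q \<subseteq> exponent_box V e"
  shows "Poly_Mapping.keys (p * q) \<subseteq> exponent_box V (d + e)"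
proof
  fix m assume "m \<in> Poly_Mapping.keys (p * q)"
  then obtain a b where ab: "m = a + b" "a \<in> Poly_Mapping.keys p" "b \<in> Poly_Mapping.keys q"
    using keys_mult[of p q] by blast
  then have "a \<in> exponent_box V d" "b \<in> exponent_box V e" using assms by auto
  then show "m \<in> exponent_box V (d + e)"
    using keys_add[of a b] by (auto simp: ab(1) exponent_box_def lookup_add intro: add_mono)
qed

lemma keys_power_subset_exponent_box:
  fixes p :: "('v, 'k::comm_ring_1) mpoly"
  assumes "Poly_Mapping.keys p \<subseteq> exponent_box V d"
  shows "Poly_Mapping.keys (p ^ e) \<subseteq> exponent_box V (e * d)"
proof (induction e)
  case (Suc e)
  show ?case using keys_mult_subset_exponent_box[OF assms Suc] by simp
qed (simp add: exponent_box_def)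

lemma exponent_box_mono: "d \<le> e \<Longrightarrow> exponent_box V d \<subseteq> exponent_box V e"
  by (auto simp: exponent_box_def intro: order_trans)

lemma keys_pow_prod_subset_exponent_box:
  fixes as :: "('v, 'k::comm_ring_1) mpoly list"
  assumes "\<And>a. a \<in> set as \<Longrightarrow> Poly_Mapping.keys a \<subseteq> exponent_box V d" "set es \<subseteq> {..N}"
  shows "Poly_Mapping.keys (pow_prod as es) \<subseteq> exponent_box V (length as * N * d)"
  using assms
proof (induction as es rule: pow_prod.induct)
  case (1 a as e es)
  have "Poly_Mapping.keys (a ^ e) \<subseteq> exponent_box V (N * d)"
    using keys_power_subset_exponent_box[of a V d e]
      exponent_box_mono[of "e * d" "N * d" V] 1(2,3)
    by auto
  then show ?case
    using keys_mult_subset_exponent_box[of "a ^ e" V "N * d" "pow_prod as es" "length as * N * d"] 1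
    by (simp add: algebra_simps)
qed (simp_all add: exponent_box_def)

lemma exists_exponent_box:
  fixes A :: "('v, 'k::comm_ring_1) mpoly set"
  assumes "finite A" "A \<subseteq> carrier (poly_ring V)"
  obtains d where "\<And>a. a \<in> A \<Longrightarrow> Poly_Mapping.keys a \<subseteq> exponent_box V d"
proof -
  have "finite (\<Union>a\<in>A. \<Union>m\<in>Poly_Mapping.keys a. Poly_Mapping.lookup m ` Poly_Mapping.keys m)"
    using assms(1) by simp
  then obtain d where d: "\<And>a m x. a \<in> A \<Longrightarrow> m \<in> Poly_Mapping.keys a \<Longrightarrow> x \<in> Poly_Mapping.keys m
      \<Longrightarrow> Poly_Mapping.lookup m x \<le> d"
    unfolding finite_nat_set_iff_bounded_le by fastforce
  have "Poly_Mapping.keys a \<subseteq> exponent_box V d" if "a \<in> A" for a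
  proof
    fix m assume m: "m \<in> Poly_Mapping.keys a"
    have "Poly_Mapping.lookup m x \<le> d" for x
      using d[OF that m, of x] by (cases "x \<in> Poly_Mapping.keys m") (simp_all add: in_keys_iff)
    then show "m \<in> exponent_box V d" using assms(2) that m
      by (force simp: exponent_box_def in_carrier_poly_ring subset_iff)
  qed
  then show ?thesis using that by blast
qed

lemma card_exponent_box:
  assumes "finite V"
  shows "finite (exponent_box V d)" "card (exponent_box V d) \<le> (d + 1) ^ card V"
proof -
  let ?f = "\<lambda>m. restrict (Poly_Mapping.lookup m) V"
  have inj: "inj_on ?f (exponent_box V d)"
  proof (rule inj_onI, rule poly_mapping_eqI)
    fix m m' x assume m: "m \<in> exponent_box V d" "m' \<in> exponent_box V d" "?f m = ?f m'"
    show "Poly_Mapping.lookup m x = Poly_Mapping.lookup m' x"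
    proof (cases "x \<in> V")
      case True
      then show ?thesis using fun_cong[OF m(3), of x] by simp
    next
      case False
      then have "x \<notin> Poly_Mapping.keys m" "x \<notin> Poly_Mapping.keys m'"
        using m(1,2) by (auto simp: exponent_box_def)
      then show ?thesis by (simp add: in_keys_iff)
    qed
  qed
  have sub: "?f ` exponent_box V d \<subseteq> V \<rightarrow>\<^sub>E {..d}" by (auto simp: exponent_box_def)
  have fin: "finite (V \<rightarrow>\<^sub>E {..d})" using assms by (simp add: finite_PiE)
  show "finite (exponent_box V d)" using inj sub fin by (metis finite_imageD finite_subset)
  show "card (exponent_box V d) \<le> (d + 1) ^ card V"
    using card_inj_on_le[OF inj sub fin] assms by (simp add: card_PiE)
qed

lemma vector_space_mpoly:
  "vector_space (\<lambda>c (p :: ('v, 'k::field) mpoly). Poly_Mapping.single 0 c * p)"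
  by unfold_locales
     (simp_all add: distrib_left distrib_right single_add mult_single mult.assoc[symmetric])

text \<open>
  The span of the monomials in the box has at most \<open>(d + 1) ^ card V\<close> generators.
\<close>

lemma card_independent_le:
  fixes S :: "('v, 'k::field) mpoly set"
  assumes "finite V" and "\<And>p. p \<in> S \<Longrightarrow> Poly_Mapping.keys p \<subseteq> exponent_box V d"
    and "\<And>F c. finite F \<Longrightarrow> F \<subseteq> S \<Longrightarrow> (\<Sum>p\<in>F. Poly_Mapping.single 0 (c p) * p) = 0
      \<Longrightarrow> \<forall>p\<in>F. c p = 0"
  shows "card S \<le> (d + 1) ^ card V"
proof -
  interpret vector_space "\<lambda>c (p :: ('v, 'k) mpoly). Poly_Mapping.single 0 c * p"
    by (rule vector_space_mpoly)
  let ?B = "(\<lambda>m. Poly_Mapping.single m (1 :: 'k)) ` exponent_box V d"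
  have "independent S"
    unfolding independent_explicit_finite_subsets using assms(3) by blast
  moreover have "S \<subseteq> span ?B"
  proof
    fix p assume "p \<in> S"
    then have "Poly_Mapping.keys p \<subseteq> exponent_box V d" by (rule assms(2))
    then have "(\<Sum>m\<in>Poly_Mapping.keys p.
        Poly_Mapping.single 0 (Poly_Mapping.lookup p m) * Poly_Mapping.single m 1) \<in> span ?B"
      by (intro span_sum span_scale span_base) auto
    then show "p \<in> span ?B" by (simp add: mult_single sum_single_lookup)
  qed
  ultimately have "card S \<le> card ?B"
    using independent_span_bound[of ?B S] card_exponent_box(1)[OF assms(1)] by simp
  also have "\<dots> \<le> card (exponent_box V d)" by (rule card_image_le[OF card_exponent_box(1)[OF assms(1)]])
  also have "\<dots> \<le> (d + 1) ^ card V" by (rule card_exponent_box(2)[OF assms(1)])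
  finally show ?thesis .
qed

text \<open>
  The inequality \<open>dim K[V] \<le> |V|\<close>. A chain of length \<open>k\<close> gives \<open>k\<close> elements with linearly
  independent monomials, so the \<open>(N + 1) ^ k\<close> monomials with exponents up to \<open>N\<close> all differ and
  are independent. Their exponents in the variables are bounded by a multiple of \<open>N\<close>, so they
  live in a space of dimension \<open>O(N ^ card V)\<close>. Comparing growth rates gives \<open>k \<le> card V\<close>.
\<close>

lemma prime_chain_length_le:
  fixes P :: "nat \<Rightarrow> ('v, 'k::field) mpoly set"
  assumes "finite V" and chain: "prime_chain (poly_ring V) k P"
  shows "k \<le> card V"
proof (rule ccontr)
  assume "\<not> k \<le> card V"
  then have k: "card V + 1 \<le> k" by simp
  have "\<forall>i<k. \<exists>a. a \<in> P (Suc i) - P i" using chain by (auto simp: prime_chain_def)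
  then obtain a where a: "\<And>i. i < k \<Longrightarrow> a i \<in> P (Suc i) - P i" by metis
  define as where "as = map a [0..<k]"
  have len: "length as = k" and nth: "\<And>i. i < length as \<Longrightarrow> as ! i \<in> P (Suc i) - P i"
    using a by (simp_all add: as_def)
  have "P (Suc i) \<subseteq> carrier (poly_ring V)" if "i < k" for i
    using chain that
    by (intro ideal_poly_ringD(1)[OF primeideal_poly_ringD(1)]) (simp add: prime_chain_def)
  then have "set as \<subseteq> carrier (poly_ring V)" using a by (fastforce simp: as_def)
  then obtain d where d: "\<And>a. a \<in> set as \<Longrightarrow> Poly_Mapping.keys a \<subseteq> exponent_box V d"
    using exists_exponent_box[of "set as" V] by auto
  have "0 \<in> P 0"
    using chain
    by (intro ideal_poly_ringD(2)[OF primeideal_poly_ringD(1), of _ V]) (simp add: prime_chain_def)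
  have indep: "\<forall>es\<in>E. c es = 0"
    if "finite E" "\<And>es. es \<in> E \<Longrightarrow> length es = k"
      "(\<Sum>es\<in>E. Poly_Mapping.single 0 (c es) * pow_prod as es) = 0" for E c
  proof -
    have "(\<Sum>es\<in>{es\<in>E. c es \<noteq> 0}. Poly_Mapping.single 0 (c es) * pow_prod as es)
        = (\<Sum>es\<in>E. Poly_Mapping.single 0 (c es) * pow_prod as es)"
      using that(1) by (intro sum.mono_neutral_left) auto
    also have "\<dots> = 0" by (rule that(3))
    finally have "(\<Sum>es\<in>{es\<in>E. c es \<noteq> 0}. Poly_Mapping.single 0 (c es) * pow_prod as es) \<in> P 0"
      using \<open>0 \<in> P 0\<close> by simp
    then have "{es\<in>E. c es \<noteq> 0} = {}"
    proof (rule pow_prods_independent_mod_prime[rotated -1])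
      show "prime_chain (poly_ring V) (length as) P" using chain len by simp
      show "finite {es\<in>E. c es \<noteq> 0}" using that(1) by simp
    qed (use nth that(2) len in auto)
    then show ?thesis by auto
  qed
  \<comment> \<open>with the constant \<open>C = k * d + 1\<close>, the count gives \<open>(N + 1) ^ k \<le> (C * (N + 1)) ^ card V\<close>,
    which fails for \<open>k > card V\<close> as soon as \<open>N + 1 > C ^ card V\<close>\<close>
  define N where "N = (k * d + 1) ^ card V"
  let ?E = "{es. set es \<subseteq> {..N} \<and> length es = k}"
  have inj: "inj_on (pow_prod as) ?E"
  proof (rule inj_onI, rule ccontr)
    fix es es' assume *: "es \<in> ?E" "es' \<in> ?E" "pow_prod as es = pow_prod as es'" "es \<noteq> es'"
    then show False
      \<comment> \<open>two equal monomials would give the relation \<open>1 * m - 1 * m = 0\<close>\<close>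
      using indep[of "{es, es'}" "\<lambda>e. if e = es then 1 else - 1"]
      by (auto simp: single_uminus)
  qed
  have "card (pow_prod as ` ?E) \<le> (k * N * d + 1) ^ card V"
  proof (rule card_independent_le[OF assms(1)])
    show "Poly_Mapping.keys p \<subseteq> exponent_box V (k * N * d)" if "p \<in> pow_prod as ` ?E" for p
      using that keys_pow_prod_subset_exponent_box[OF d] len by auto
    fix F c assume F: "finite F" "F \<subseteq> pow_prod as ` ?E"
      "(\<Sum>p\<in>F. Poly_Mapping.single 0 (c p) * p) = (0 :: ('v, 'k) mpoly)"
    define E where "E = {es\<in>?E. pow_prod as es \<in> F}"
    have FE: "F = pow_prod as ` E" using F(2) by (auto simp: E_def)
    have "inj_on (pow_prod as) E" using inj by (rule inj_on_subset) (auto simp: E_def)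
    then have "(\<Sum>es\<in>E. Poly_Mapping.single 0 (c (pow_prod as es)) * pow_prod as es) = 0"
      using F(3) by (simp add: FE sum.reindex)
    moreover have "finite E" 
      by (rule finite_subset[OF _ finite_lists_length_eq[of "{..N}" k]]) (auto simp: E_def)
    ultimately have "\<forall>es\<in>E. c (pow_prod as es) = 0"
      using indep[of E "\<lambda>es. c (pow_prod as es)"] unfolding E_def by blast
    then show "\<forall>p\<in>F. c p = 0" unfolding FE by blast
  qed
  then have "(N + 1) ^ k \<le> (k * N * d + 1) ^ card V"
    by (simp add: card_image[OF inj] card_lists_length_eq)
  also have "\<dots> \<le> ((k * d + 1) * (N + 1)) ^ card V"
    by (intro power_mono) (simp_all add: algebra_simps)
  also have "\<dots> = N * (N + 1) ^ card V" by (simp only: power_mult_distrib N_def)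
  also have "\<dots> < (N + 1) ^ (card V + 1)" by simp
  also have "\<dots> \<le> (N + 1) ^ k" using k by (intro power_increasing) simp_all
  finally show False by simp
qed

section \<open>Chains of primes\<close>

text \<open>
  The inclusion at the joint need not be strict: the end \<open>P k\<close> is dropped in favour of \<open>Q 0\<close>,
  and the step from \<open>P (k - 1)\<close> remains strict. Lower bounds for heights use this with a
  chain \<open>Q\<close> of length \<open>0\<close> in order to replace the end of \<open>P\<close> by a larger prime.
\<close>

lemma prime_chain_append:
  assumes P: "prime_chain R k P" and Q: "prime_chain R l Q" and "P k \<subseteq> Q 0"
  shows "prime_chain R (k + l) (\<lambda>i. if i < k then P i else Q (i - k))"
    (is "prime_chain R (k + l) ?C")
  unfolding prime_chain_def
proof (intro conjI allI impI)
  show "primeideal (?C i) R" if "i \<le> k + l" for i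
    using P Q that by (auto simp: prime_chain_def)
  show "?C i \<subset> ?C (Suc i)" if i: "i < k + l" for i
  proof (cases "i < k")
    case True
    then have "P i \<subset> P (Suc i)" using P by (simp add: prime_chain_def)
    then show ?thesis using True assms(3) by (cases "Suc i = k") auto
  next
    case False
    then have "Q (i - k) \<subset> Q (Suc (i - k))" using Q i by (simp add: prime_chain_def)
    then show ?thesis using False by (simp add: Suc_diff_le)
  qed
qed

lemma prime_chain_mono:
  assumes "prime_chain R k P" "i \<le> k"
  shows "P 0 \<subseteq> P i"
  using assms(2)
proof (induction i)
  case (Suc i)
  then have "P 0 \<subseteq> P i" "P i \<subset> P (Suc i)" using assms(1) by (simp_all add: prime_chain_def)
  then show ?case by blast
qed simp

lemma (in cring) primeideal_image_Quot:
  assumes I: "ideal I R" and P: "primeideal P R" and "I \<subseteq> P"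
  shows "primeideal ((+>) I ` P) (R Quot I)"
    and "x \<in> carrier R \<Longrightarrow> I +> x \<in> (+>) I ` P \<longleftrightarrow> x \<in> P"
proof -
  interpret I: ideal I R by (rule I)
  interpret P: ideal P R using P by (simp add: primeideal_def)
  show mem: "I +> x \<in> (+>) I ` P \<longleftrightarrow> x \<in> P" if x: "x \<in> carrier R" for x
  proof
    assume "I +> x \<in> (+>) I ` P"
    then obtain y where y: "y \<in> P" "I +> x = I +> y" by auto
    then have "x \<in> I +> y" using I.a_rcos_self[OF x] by simp
    then obtain i where "i \<in> I" "x = i \<oplus> y" by (auto simp: a_r_coset_def')
    then show "x \<in> P" using P.a_closed y(1) assms(3) by blast
  next
    assume "x \<in> P" then show "I +> x \<in> (+>) I ` P" by blast
  qed
  show "primeideal ((+>) I ` P) (R Quot I)"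
  proof (rule primeidealI)
    show "ideal ((+>) I ` P) (R Quot I)" by (rule ring_ideal_imp_quot_ideal[OF I P.is_ideal])
    show "cring (R Quot I)" by (rule I.quotient_is_cring[OF is_cring])
    have "I +> \<one> \<notin> (+>) I ` P"
      using mem[OF one_closed] P.one_imp_carrier primeideal.I_notcarr[OF P] by auto
    moreover have "I +> \<one> \<in> carrier (R Quot I)" by (auto simp: FactRing_simps)
    ultimately show "carrier (R Quot I) \<noteq> (+>) I ` P" by blast
    fix X Y assume "X \<in> carrier (R Quot I)" "Y \<in> carrier (R Quot I)"
      and XY: "X \<otimes>\<^bsub>R Quot I\<^esub> Y \<in> (+>) I ` P"
    then obtain x y where xy: "x \<in> carrier R" "X = I +> x" "y \<in> carrier R" "Y = I +> y"
      by (auto simp: FactRing_simps)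
    then have "x \<otimes> y \<in> P"
      using XY mem[of "x \<otimes> y"] by (simp add: FactRing_def I.rcoset_mult_add)
    then have "x \<in> P \<or> y \<in> P" by (rule primeideal.I_prime[OF P xy(1,3)])
    then show "X \<in> (+>) I ` P \<or> Y \<in> (+>) I ` P" using xy(2,4) by blast
  qed
qed

text \<open>
  Contraction along \<open>R \<rightarrow> R/I\<close> and its inverse, the image, preserve primality and strict
  inclusions, so chains of primes of \<open>R/I\<close> are chains of primes of \<open>R\<close> above \<open>I\<close>.
\<close>

lemma (in cring) krull_dim_Quot:
  assumes I: "ideal I R"
  shows "krull_dim (R Quot I) = Sup {enat k | k P. prime_chain R k P \<and> I \<subseteq> P 0}"
proof -
  have zero: "\<zero>\<^bsub>R Quot I\<^esub> = I" by (simp add: FactRing_def)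
  have carr: "carrier (R Quot I) = (+>) I ` carrier R"
    unfolding FactRing_def A_RCOSETS_def' by auto
  interpret I: ideal I R by (rule I)
  interpret h: ring_hom_ring R "R Quot I" "(+>) I" by (rule I.rcos_ring_hom_ring)
  have down: "\<exists>Q. prime_chain R k Q \<and> I \<subseteq> Q 0" if chain: "prime_chain (R Quot I) k P" for k P
  proof (intro exI conjI)
    let ?Q = "\<lambda>i. {r \<in> carrier R. I +> r \<in> P i}"
    have prime: "primeideal (P i) (R Quot I)" if "i \<le> k" for i
      using chain that by (simp add: prime_chain_def)
    have sub: "P i \<subseteq> carrier (R Quot I)" if "i \<le> k" for i
      using prime[OF that] by (simp add: primeideal_def ideal_def additive_subgroup.a_subset)
    show "prime_chain R k ?Q"
      unfolding prime_chain_def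
    proof (intro conjI allI impI)
      show "primeideal (?Q i) R" if "i \<le> k" for i
        by (rule h.primeideal_vimage[OF is_cring prime[OF that]])
      fix i assume i: "i < k"
      then have lt: "P i \<subset> P (Suc i)" using chain by (simp add: prime_chain_def)
      then obtain X where X: "X \<in> P (Suc i)" "X \<notin> P i" by blast
      then obtain r where "r \<in> carrier R" "X = I +> r" using sub[of "Suc i"] i carr by auto
      then have "r \<in> ?Q (Suc i)" "r \<notin> ?Q i" using X by simp_all
      moreover have "?Q i \<subseteq> ?Q (Suc i)" using lt by auto
      ultimately show "?Q i \<subset> ?Q (Suc i)" by blast
    qed
    have "ideal (P 0) (R Quot I)" using prime[of 0] by (simp add: primeideal_def)
    then have "\<zero>\<^bsub>R Quot I\<^esub> \<in> P 0" by (intro additive_subgroup.zero_closed ideal.axioms(1))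
    then have "I \<in> P 0" by (simp only: zero)
    then show "I \<subseteq> ?Q 0" using I.a_rcos_const I.Icarr by (simp add: subset_iff)
  qed
  have up: "\<exists>Q. prime_chain (R Quot I) k Q" if chain: "prime_chain R k P" "I \<subseteq> P 0" for k P
  proof
    have sub: "I \<subseteq> P i" if "i \<le> k" for i
      using prime_chain_mono[OF chain(1) that] chain(2) by blast
    have prime: "primeideal (P i) R" if "i \<le> k" for i
      using chain that by (simp add: prime_chain_def)
    show "prime_chain (R Quot I) k (\<lambda>i. (+>) I ` P i)"
      unfolding prime_chain_def
    proof (intro conjI allI impI)
      show "primeideal ((+>) I ` P i) (R Quot I)" if "i \<le> k" for i
        by (rule primeideal_image_Quot(1)[OF I prime[OF that] sub[OF that]])
      fix i assume i: "i < k"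
      then have lt: "P i \<subset> P (Suc i)" using chain by (simp add: prime_chain_def)
      then obtain r where r: "r \<in> P (Suc i)" "r \<notin> P i" by blast
      moreover have "r \<in> carrier R"
        by (rule ideal.Icarr[OF primeideal.axioms(1)[OF prime] r(1)]) (use i in simp)
      ultimately have "I +> r \<notin> (+>) I ` P i"
        using primeideal_image_Quot(2)[OF I prime sub, of i r] i by simp
      then show "(+>) I ` P i \<subset> (+>) I ` P (Suc i)" using lt r(1) by blast
    qed
  qed
  have "{enat k | k P. prime_chain (R Quot I) k P} = {enat k | k P. prime_chain R k P \<and> I \<subseteq> P 0}"
    using down up by blast
  then show ?thesis by (simp add: krull_dim_def)
qed

section \<open>Ideals generated by variables\<close>

lemma (in cring) ideal_of_closures:
  assumes "I \<subseteq> carrier R" "\<zero> \<in> I"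
    and "\<And>x y. x \<in> I \<Longrightarrow> y \<in> I \<Longrightarrow> x \<oplus> y \<in> I"
    and mult: "\<And>r x. r \<in> carrier R \<Longrightarrow> x \<in> I \<Longrightarrow> r \<otimes> x \<in> I"
  shows "ideal I R"
proof (rule idealI)
  show "ring R" by (rule ring_axioms)
  show "subgroup I (add_monoid R)"
  proof (rule add.subgroupI)
    fix x assume x: "x \<in> I"
    then have "\<ominus> \<one> \<otimes> x \<in> I" by (intro mult) simp_all
    then show "\<ominus> x \<in> I" using x assms(1) by (simp add: l_minus subsetD)
  qed (use assms in auto)
  fix x r assume x: "x \<in> I" "r \<in> carrier R"
  then show "r \<otimes> x \<in> I" by (intro mult)
  then show "x \<otimes> r \<in> I" using x assms(1) by (simp add: m_comm subsetD)
qed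

text \<open>
  For \<open>S \<subseteq> V\<close>, the ideal generated by the variables in \<open>S\<close>: a polynomial lies in it iff each of its
  monomials involves one of them. Membership of a polynomial is thus decided by its
  monomials. For \<open>S = {}\<close> this is the zero ideal.
\<close>

definition var_ideal :: "'v set \<Rightarrow> 'v set \<Rightarrow> ('v, 'k::comm_ring_1) mpoly set" where
  "var_ideal V S =
    {p \<in> carrier (poly_ring V). \<forall>m \<in> Poly_Mapping.keys p. Poly_Mapping.keys m \<inter> S \<noteq> {}}"

lemma ideal_var_ideal: "ideal (var_ideal V S :: ('v, 'k::comm_ring_1) mpoly set) (poly_ring V)"
proof (rule cring.ideal_of_closures[OF cring_poly_ring])
  let ?I = "var_ideal V S :: ('v, 'k) mpoly set"
  show "?I \<subseteq> carrier (poly_ring V)" "\<zero>\<^bsub>poly_ring V\<^esub> \<in> ?I"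
    by (auto simp: var_ideal_def in_carrier_poly_ring)
  fix p q :: "('v, 'k) mpoly"
  show "p \<oplus>\<^bsub>poly_ring V\<^esub> q \<in> ?I" if "p \<in> ?I" "q \<in> ?I"
    using that keys_add[of p q] by (auto simp: var_ideal_def poly_ring_closed)
  show "p \<otimes>\<^bsub>poly_ring V\<^esub> q \<in> ?I" if pq: "p \<in> carrier (poly_ring V)" "q \<in> ?I"
  proof -
    have "Poly_Mapping.keys m \<inter> S \<noteq> {}" if m: "m \<in> Poly_Mapping.keys (p * q)" for m
    proof -
      obtain a b where ab: "m = a + b" "b \<in> Poly_Mapping.keys q"
        using m keys_mult[of p q] by blast
      have "Poly_Mapping.keys b \<subseteq> Poly_Mapping.keys m"
        by (auto simp: ab(1) in_keys_iff lookup_add)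
      then show ?thesis using ab(2) pq(2) by (auto simp: var_ideal_def)
    qed
    then show ?thesis using pq by (simp add: var_ideal_def poly_ring_closed)
  qed
qed

text \<open>
  Modulo this ideal \<open>p\<close> agrees with \<open>avoid p\<close>, the sum of its terms free of the variables in
  \<open>S\<close>. No monomial of \<open>avoid p * avoid q\<close> meets \<open>S\<close>, so that product lies in the ideal only if
  it is zero. Then one factor is zero because polynomials form an integral domain; the
  library derives this from a linear order on the exponent vectors, which is why the
  variables are linearly ordered.
\<close>

lemma primeideal_var_ideal:
  "primeideal (var_ideal V S :: ('v::linorder, 'k::field) mpoly set) (poly_ring V)"
proof (rule primeidealI)
  let ?I = "var_ideal V S :: ('v, 'k) mpoly set"
  note I = ideal_poly_ringD[OF ideal_var_ideal[of V S, where 'k = 'k]]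
  show "ideal ?I (poly_ring V)" by (rule ideal_var_ideal)
  show "cring (poly_ring V :: ('v, 'k) mpoly ring)" by (rule cring_poly_ring)
  have "1 \<notin> ?I" "1 \<in> carrier (poly_ring V :: ('v, 'k) mpoly ring)"
    by (simp_all add: var_ideal_def in_carrier_poly_ring)
  then show "carrier (poly_ring V) \<noteq> ?I" by metis
  define avoid where "avoid p = (\<Sum>m\<in>{m \<in> Poly_Mapping.keys p. Poly_Mapping.keys m \<inter> S = {}}.
    Poly_Mapping.single m (Poly_Mapping.lookup p m))" for p :: "('v, 'k) mpoly"
  have lookup_avoid: "Poly_Mapping.lookup (avoid p) m =
      (if Poly_Mapping.keys m \<inter> S = {} then Poly_Mapping.lookup p m else 0)" for p m
    by (simp add: avoid_def lookup_sum lookup_single when_def in_keys_iff)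
  have avoid: "avoid p \<in> carrier (poly_ring V)" "p - avoid p \<in> ?I"
    if "p \<in> carrier (poly_ring V)" for p
    using that
    by (auto simp: in_carrier_poly_ring var_ideal_def in_keys_iff lookup_minus lookup_avoid
        split: if_splits)
  fix p q :: "('v, 'k) mpoly"
  assume p: "p \<in> carrier (poly_ring V)" and q: "q \<in> carrier (poly_ring V)"
    and "p \<otimes>\<^bsub>poly_ring V\<^esub> q \<in> ?I"
  then have "p * q \<in> ?I" by simp
  moreover have "q * (p - avoid p) \<in> ?I" "avoid p * (q - avoid q) \<in> ?I"
    using I(5) avoid p q by blast+
  ultimately have "p * q - q * (p - avoid p) - avoid p * (q - avoid q) \<in> ?I"
    by (intro I(4))
  then have "avoid p * avoid q \<in> ?I" by (simp add: algebra_simps)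
  moreover have "Poly_Mapping.keys m \<inter> S = {}"
    if m: "m \<in> Poly_Mapping.keys (avoid p * avoid q)" for m
  proof -
    obtain a b where ab: "m = a + b" "a \<in> Poly_Mapping.keys (avoid p)" "b \<in> Poly_Mapping.keys (avoid q)"
      using m keys_mult[of "avoid p" "avoid q"] by blast
    then have "Poly_Mapping.keys a \<inter> S = {}" "Poly_Mapping.keys b \<inter> S = {}"
      by (auto simp: in_keys_iff lookup_avoid split: if_splits)
    then show ?thesis using keys_add[of a b] ab(1) by blast
  qed
  ultimately have "Poly_Mapping.keys (avoid p * avoid q) = {}"
    unfolding var_ideal_def by blast
  then have "avoid p * avoid q = 0" by simp
  then have "avoid p = 0 \<or> avoid q = 0" by simp
  then show "p \<in> ?I \<or> q \<in> ?I" using avoid(2)[OF p] avoid(2)[OF q] by auto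
qed

lemma var_in_var_ideal_iff:
  "(var x :: ('v, 'k::comm_ring_1) mpoly) \<in> var_ideal V S \<longleftrightarrow> x \<in> V \<inter> S"
  by (auto simp: var_ideal_def in_carrier_poly_ring var_def)

lemma var_ideal_subset_insert:
  assumes "x \<in> V" "x \<notin> S"
  shows "(var_ideal V S :: ('v, 'k::comm_ring_1) mpoly set) \<subset> var_ideal V (insert x S)"
proof -
  have "(var_ideal V S :: ('v, 'k) mpoly set) \<subseteq> var_ideal V (insert x S)"
    by (auto simp: var_ideal_def)
  moreover have "(var x :: ('v, 'k) mpoly) \<in> var_ideal V (insert x S)"
    "(var x :: ('v, 'k) mpoly) \<notin> var_ideal V S"
    using assms by (simp_all add: var_in_var_ideal_iff)
  ultimately show ?thesis by blast
qed

lemma var_ideal_least: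
  fixes Q :: "('v, 'k::comm_ring_1) mpoly set"
  assumes Q: "ideal Q (poly_ring V)" and "\<And>x. x \<in> S \<Longrightarrow> var x \<in> Q"
  shows "var_ideal V S \<subseteq> Q"
proof
  fix p :: "('v, 'k) mpoly" assume p: "p \<in> var_ideal V S"
  have "(\<Sum>m\<in>Poly_Mapping.keys p. Poly_Mapping.single m (Poly_Mapping.lookup p m)) \<in> Q"
  proof (rule ideal_sum_closed[OF Q])
    fix m assume m: "m \<in> Poly_Mapping.keys p"
    then obtain x where x: "x \<in> Poly_Mapping.keys m" "x \<in> S"
      using p by (auto simp: var_ideal_def)
    define m' where "m' = m - Poly_Mapping.single x 1"
    have "m = m' + Poly_Mapping.single x 1"
      using x(1)
      by (intro poly_mapping_eqI)
         (auto simp: m'_def lookup_add lookup_minus lookup_single when_def in_keys_iff)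
    then have "Poly_Mapping.single m c = Poly_Mapping.single m' c * var x" for c :: 'k
      by (simp add: var_def mult_single)
    moreover have "Poly_Mapping.keys m' \<subseteq> Poly_Mapping.keys m"
      by (auto simp: m'_def in_keys_iff lookup_minus)
    then have "Poly_Mapping.single m' c \<in> carrier (poly_ring V)" for c :: 'k
      using p m by (intro single_in_carrier) (auto simp: var_ideal_def in_carrier_poly_ring)
    ultimately show "Poly_Mapping.single m (Poly_Mapping.lookup p m) \<in> Q"
      using ideal_poly_ringD(5)[OF Q assms(2)[OF x(2)]] by metis
  qed
  then show "p \<in> Q" by (simp add: sum_single_lookup)
qed

text \<open>
  Adjoining the variables of \<open>T - S\<close> one at a time gives a chain of primes. These explicit
  chains supply all lower bounds, and pad given chains when an upper bound is derived.
\<close>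

lemma var_ideal_flag:
  assumes "finite V" "S \<subseteq> T" "T \<subseteq> V"
  obtains P :: "nat \<Rightarrow> ('v::linorder, 'k::field) mpoly set"
  where "prime_chain (poly_ring V) (card (T - S)) P" "P 0 = var_ideal V S"
    "P (card (T - S)) = var_ideal V T"
proof -
  have "finite (T - S)" using assms by (meson finite_Diff finite_subset)
  then obtain xs where xs: "set xs = T - S" "distinct xs" using finite_distinct_list by blast
  then have len: "card (T - S) = length xs" using distinct_card by fastforce
  define P :: "nat \<Rightarrow> ('v, 'k) mpoly set" where "P i = var_ideal V (S \<union> set (take i xs))" for i
  have "prime_chain (poly_ring V) (length xs) P"
    unfolding prime_chain_def
  proof (intro conjI allI impI)
    show "primeideal (P i) (poly_ring V)" for i
      unfolding P_def by (rule primeideal_var_ideal)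
    fix i assume i: "i < length xs"
    then have "xs ! i \<in> T - S" using xs(1) nth_mem by blast
    moreover have "xs ! i \<notin> set (take i xs)"
      using i xs(2) by (auto simp: in_set_conv_nth nth_eq_iff_index_eq)
    moreover have "set (take (Suc i) xs) = insert (xs ! i) (set (take i xs))"
      using i by (simp add: take_Suc_conv_app_nth)
    ultimately show "P i \<subset> P (Suc i)"
      using var_ideal_subset_insert[of "xs ! i" V "S \<union> set (take i xs)"] assms(3)
      by (auto simp: P_def)
  qed
  moreover have "P 0 = var_ideal V S" "P (length xs) = var_ideal V T"
    using xs(1) assms(2) by (simp_all add: P_def Un_absorb1)
  ultimately show ?thesis using that len by simp
qed

text \<open>
  When every prime above \<open>I\<close> contains \<open>card S\<close> variables, \<open>var_ideal V S\<close> is a smallest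
  variable ideal above \<open>I\<close>, and it computes both invariants. The lower bounds are
  flags of variable ideals. For the upper bounds, a chain ending at \<open>var_ideal V S\<close> is continued
  by a flag of length \<open>card V - card S\<close> up to the ideal of all variables, and a chain starting
  above \<open>I\<close> is preceded by a flag of length \<open>card S\<close>; neither composite may be longer than
  \<open>card V\<close>.
\<close>

theorem height_krull_dim_by_covers:
  fixes I :: "('v::linorder, 'k::field) mpoly set"
  assumes V: "finite V" and I: "ideal I (poly_ring V)"
    and S: "S \<subseteq> V" "I \<subseteq> var_ideal V S"
    and covers: "\<And>Q. primeideal Q (poly_ring V) \<Longrightarrow> I \<subseteq> Q
      \<Longrightarrow> \<exists>T\<subseteq>V. card T = card S \<and> (\<forall>x\<in>T. var x \<in> Q)"
  shows "height (poly_ring V) I = enat (card S)"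
    and "krull_dim (poly_ring V Quot I) = enat (card V - card S)"
proof -
  let ?R = "poly_ring V :: ('v, 'k) mpoly ring"
  have below: "\<exists>P. prime_chain ?R (card S) P \<and> P (card S) \<subseteq> Q"
    if Q: "primeideal Q ?R" "I \<subseteq> Q" for Q
  proof -
    obtain T where T: "T \<subseteq> V" "card T = card S" "\<And>x. x \<in> T \<Longrightarrow> var x \<in> Q"
      using covers[OF Q] by blast
    obtain P :: "nat \<Rightarrow> ('v, 'k) mpoly set"
      where "prime_chain ?R (card T) P" "P (card T) = var_ideal V T"
      using var_ideal_flag[OF V empty_subsetI T(1), unfolded Diff_empty] by blast
    moreover have "var_ideal V T \<subseteq> Q"
      using var_ideal_least[OF primeideal_poly_ringD(1)[OF Q(1)]] T(3) by blast
    ultimately show ?thesis using T(2) by auto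
  qed
  have cardS: "card S \<le> card V" using V S(1) by (rule card_mono)
  obtain F :: "nat \<Rightarrow> ('v, 'k) mpoly set"
    where F: "prime_chain ?R (card (V - S)) F" "F 0 = var_ideal V S"
      "F (card (V - S)) = var_ideal V V"
    by (rule var_ideal_flag[OF V S(1) order_refl])
  have card_diff: "card (V - S) = card V - card S"
    using V S(1) by (simp add: card_Diff_subset finite_subset)
  show "height ?R I = enat (card S)"
  proof (rule antisym)
    have "prime_height ?R (var_ideal V S) \<le> enat (card S)"
      unfolding prime_height_def
    proof (rule Sup_least)
      fix h assume "h \<in> {enat k | k P. prime_chain ?R k P \<and> P k = var_ideal V S}"
      then obtain k P where h: "h = enat k" "prime_chain ?R k P" "P k = var_ideal V S" by blast
      then have "k + card (V - S) \<le> card V"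
        using prime_chain_length_le[OF V prime_chain_append[OF h(2) F(1)]] F(2) by simp
      then show "h \<le> enat (card S)" using cardS card_diff h(1) by simp
    qed
    moreover have "primeideal (var_ideal V S) ?R" by (rule primeideal_var_ideal)
    ultimately show "height ?R I \<le> enat (card S)"
      unfolding height_def using S(2) by (intro INF_lower2[of "var_ideal V S"]) simp_all
    show "enat (card S) \<le> height ?R I"
      unfolding height_def
    proof (rule INF_greatest)
      fix Q assume "Q \<in> {Q. primeideal Q ?R \<and> I \<subseteq> Q}"
      then have Q: "primeideal Q ?R" "I \<subseteq> Q" by simp_all
      obtain P where P: "prime_chain ?R (card S) P" "P (card S) \<subseteq> Q" using below[OF Q] by blast
      have "prime_chain ?R 0 (\<lambda>_. Q)" using Q(1) by (simp add: prime_chain_def)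
      from prime_chain_append[OF P(1) this P(2)]
      have "prime_chain ?R (card S) (\<lambda>i. if i < card S then P i else Q)" by simp
      then show "enat (card S) \<le> prime_height ?R Q"
        unfolding prime_height_def
        by (intro Sup_upper CollectI exI[of _ "card S"] exI[of _ "\<lambda>i. if i < card S then P i else Q"])
           simp
    qed
  qed
  show "krull_dim (?R Quot I) = enat (card V - card S)"
    unfolding cring.krull_dim_Quot[OF cring_poly_ring I]
  proof (rule antisym)
    show "Sup {enat k | k P. prime_chain ?R k P \<and> I \<subseteq> P 0} \<le> enat (card V - card S)"
    proof (rule Sup_least)
      fix h assume "h \<in> {enat k | k P. prime_chain ?R k P \<and> I \<subseteq> P 0}"
      then obtain k P where h: "h = enat k" "prime_chain ?R k P" "I \<subseteq> P 0" by blast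
      then have "primeideal (P 0) ?R" by (simp add: prime_chain_def)
      then obtain Q where Q: "prime_chain ?R (card S) Q" "Q (card S) \<subseteq> P 0"
        using below h(3) by blast
      have "card S + k \<le> card V"
        by (rule prime_chain_length_le[OF V prime_chain_append[OF Q(1) h(2) Q(2)]])
      then show "h \<le> enat (card V - card S)" using h(1) by simp
    qed
    show "enat (card V - card S) \<le> Sup {enat k | k P. prime_chain ?R k P \<and> I \<subseteq> P 0}"
      using F S(2) card_diff
      by (intro Sup_upper CollectI exI[of _ "card V - card S"] exI[of _ F]) simp
  qed
qed

section \<open>Helm graphs\<close>

lemma prod_in_carrier:
  assumes "\<And>x. x \<in> X \<Longrightarrow> f x \<in> carrier (poly_ring V)"
  shows "prod f X \<in> carrier (poly_ring V)"
  using assms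
  by (induction X rule: infinite_finite_induct)
     (auto intro: poly_ring_closed simp: in_carrier_poly_ring[of 1])

lemma closed_nbhd_helm_subset:
  assumes "n \<ge> 3" "x \<in> {0..2 * n}"
  shows "closed_nbhd (helm_graph n) x \<subseteq> {0..2 * n}"
proof
  fix y assume "y \<in> closed_nbhd (helm_graph n) x"
  then consider "y = x" | "{x, y} \<in> edges (helm_graph n)" unfolding closed_nbhd_def by blast
  then show "y \<in> {0..2 * n}"
  proof cases
    case 2
    then have "{x, y} \<subseteq> vertices (helm_graph n)" by (rule helm_graph_simple(1)[OF assms(1)])
    then show ?thesis by (simp add: helm_graph_def)
  qed (use assms(2) in simp)
qed

lemma spoke_in_helm: "1 \<le> i \<Longrightarrow> i \<le> n \<Longrightarrow> {0, i} \<in> edges (helm_graph n)"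
  by (simp add: helm_graph_def) blast

lemma pendant_in_helm: "1 \<le> i \<Longrightarrow> i \<le> n \<Longrightarrow> {i, n + i} \<in> edges (helm_graph n)"
  by (simp add: helm_graph_def) blast

text \<open>
  Every vertex of the graph is a rim vertex or adjacent to one, so each generator is
  divisible by a rim variable: the rim variables generate a prime ideal above \<open>CNI\<close>.
\<close>

lemma closed_nbhd_helm_meets_rim:
  assumes "n \<ge> 3" "x \<in> {0..2 * n}"
  shows "closed_nbhd (helm_graph n) x \<inter> {1..n} \<noteq> {}"
proof -
  consider "x = 0" | "x \<in> {1..n}" | "x > n" by fastforce
  then show ?thesis
  proof cases
    case 1
    then have "1 \<in> closed_nbhd (helm_graph n) x"
      using spoke_in_helm[of 1 n] assms(1) by (simp add: closed_nbhd_def)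
    moreover have "1 \<in> {1..n}" using assms(1) by simp
    ultimately show ?thesis by blast
  next
    case 2
    moreover have "x \<in> closed_nbhd (helm_graph n) x" by (simp add: closed_nbhd_def)
    ultimately show ?thesis by blast
  next
    case 3
    define i where "i = x - n"
    then have i: "x = n + i" "1 \<le> i" "i \<le> n" using 3 assms(2) by auto
    then have "i \<in> closed_nbhd (helm_graph n) x"
      using pendant_in_helm[OF i(2,3)] by (simp add: closed_nbhd_def insert_commute)
    moreover have "i \<in> {1..n}" using i(2,3) by simp
    ultimately show ?thesis by blast
  qed
qed

lemma closed_nbhd_helm_pendant:
  assumes "n \<ge> 3" "i \<in> {1..n}"
  shows "closed_nbhd (helm_graph n) (n + i) = {n + i, i}"
  using assms by (auto simp: closed_nbhd_def helm_graph_def doubleton_eq_iff)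

theorem lemma4p4:
  fixes n :: nat
    and A :: "(nat, 'k::field) mpoly ring"
    and L :: "(nat, 'k) mpoly set"
  assumes "n \<ge> 3"
    and "A = poly_ring {0..2 * n}"
    and "L = CNI (helm_graph n)"
  shows "height A L = enat n \<and> krull_dim (A Quot L) = enat (n + 1)"
proof -
  define gen :: "nat \<Rightarrow> (nat, 'k) mpoly"
    where "gen x = (\<Prod>y\<in>closed_nbhd (helm_graph n) x. var y)" for x
  interpret A: cring A unfolding assms(2) by (rule cring_poly_ring)
  have L: "L = Idl\<^bsub>A\<^esub> (gen ` {0..2 * n})"
    by (simp add: assms(2,3) CNI_def gen_def helm_graph_def)
  have gens: "gen ` {0..2 * n} \<subseteq> carrier A"
  proof (rule image_subsetI)
    fix x assume "x \<in> {0..2 * n}"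
    then show "gen x \<in> carrier A"
      unfolding gen_def assms(2) using closed_nbhd_helm_subset[OF assms(1)]
      by (intro prod_in_carrier var_in_carrier) blast
  qed
  have ideal: "ideal L (poly_ring {0..2 * n})"
    using A.genideal_ideal[OF gens] by (simp add: L assms(2))
  have subset: "L \<subseteq> var_ideal {0..2 * n} {1..n}"
    unfolding L
  proof (rule A.genideal_minimal)
    show "ideal (var_ideal {0..2 * n} {1..n}) A" unfolding assms(2) by (rule ideal_var_ideal)
    show "gen ` {0..2 * n} \<subseteq> var_ideal {0..2 * n} {1..n}"
    proof (rule image_subsetI)
      fix x assume x: "x \<in> {0..2 * n}"
      note nbhd = closed_nbhd_helm_subset[OF assms(1) x]
      then have fin: "finite (closed_nbhd (helm_graph n) x)" by (rule finite_subset) simp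
      obtain y where y: "y \<in> closed_nbhd (helm_graph n) x" "y \<in> {1..n}"
        using closed_nbhd_helm_meets_rim[OF assms(1) x] by blast
      have "(\<Prod>z\<in>closed_nbhd (helm_graph n) x - {y}. var z) * (var y :: (nat, 'k) mpoly)
          \<in> var_ideal {0..2 * n} {1..n}"
        using nbhd y(2)
        by (intro ideal_poly_ringD(5)[OF ideal_var_ideal] prod_in_carrier var_in_carrier)
           (auto simp: var_in_var_ideal_iff)
      then show "gen x \<in> var_ideal {0..2 * n} {1..n}"
        by (simp add: gen_def prod.remove[OF fin y(1)] mult.commute)
    qed
  qed
  have covers: "\<exists>T\<subseteq>{0..2 * n}. card T = card {1..n} \<and> (\<forall>x\<in>T. var x \<in> Q)"
    if Q: "primeideal Q (poly_ring {0..2 * n})" "L \<subseteq> Q" for Q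
  proof -
    have pair: "var i \<in> Q \<or> var (n + i) \<in> Q" if i: "i \<in> {1..n}" for i
    proof -
      have "n + i \<in> {0..2 * n}" using i by simp
      then have "gen (n + i) \<in> Q" using A.genideal_self[OF gens] Q(2) unfolding L by blast
      moreover have "gen (n + i) = var i * var (n + i)"
        using i by (simp add: gen_def closed_nbhd_helm_pendant[OF assms(1) i] mult.commute)
      ultimately show ?thesis
        using primeideal_poly_ringD(3)[OF Q(1) var_in_carrier var_in_carrier, of i "n + i"] i by simp
    qed
    \<comment> \<open>one vertex from each pendant edge, chosen so that its variable lies in \<open>Q\<close>\<close>
    define f where "f i = (if (var i :: (nat, 'k) mpoly) \<in> Q then i else n + i)" for i
    have "inj_on f {1..n}" by (auto simp: f_def inj_on_def)
    then have "card (f ` {1..n}) = card {1..n}" by (rule card_image)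
    moreover have "f ` {1..n} \<subseteq> {0..2 * n}" by (auto simp: f_def)
    moreover have "var (f i) \<in> Q" if "i \<in> {1..n}" for i
      using pair[OF that] by (auto simp: f_def)
    ultimately show ?thesis by blast
  qed
  have "{1..n} \<subseteq> {0..2 * n}" by auto
  note covered = height_krull_dim_by_covers[OF _ ideal this subset covers]
  have "card {0..2 * n} - card {1..n} = n + 1" by simp
  then show ?thesis using covered by (simp add: assms(2))
qed

end
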